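(* Let $M$ be an acyclic oriented matroid represented over $\mathbb{R}$ by a finite (multi)set of vectors $E\subset\mathbb{R}^n$. The number of transitive $2$-colorings of $M$ is equal to the number of chambers in the dual hyperplane arrangement.
   Context: The signed circuits of the oriented matroid represented by $E$ are the pairs $(X^+,X^-)$ given by the signs of the coefficients of the linear dependencies among $E$ with inclusion-minimal nonempty support. It is acyclic if it has no signed circuit with $X^-=\varnothing$ (equivalently, no nontrivial nonnegative linear combination of vectors of $E$ is $0$). A transitive $2$-coloring of $M$ is a function $\varepsilon$ from $E$ to a 2-element set of colors such that $\varepsilon(X^+)\cap\varepsilon(X^-)\ne\varnothing$ for every signed circuit $(X^+,X^-)$. The dual hyperplane arrangement consists of the hyperplanes $\{x\in\mathbb{R}^n: x^t e=0\}$, $e\in E$; its chambers are the connected components of the complement in $\mathbb{R}^n$ of the union of these hyperplanes. *)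

theory Defs
  imports "HOL-Analysis.Analysis"
begin

text \<open>
  A finite multiset of vectors in \<open>\<real>\<^sup>n\<close> is a family \<open>v\<close> indexed by a finite set \<open>E\<close>; the indices form
  the ground set of the oriented matroid, so repeated vectors are distinct elements.
\<close>

definition linear_dependency :: "'i set \<Rightarrow> ('i \<Rightarrow> real ^ 'n) \<Rightarrow> ('i \<Rightarrow> real) \<Rightarrow> bool" where
  "linear_dependency E v c \<longleftrightarrow> (\<Sum>i\<in>E. c i *\<^sub>R v i) = 0"

definition support_in :: "'i set \<Rightarrow> ('i \<Rightarrow> real) \<Rightarrow> 'i set" where
  "support_in E c = {i \<in> E. c i \<noteq> 0}"

definition minimal_dependency :: "'i set \<Rightarrow> ('i \<Rightarrow> real ^ 'n) \<Rightarrow> ('i \<Rightarrow> real) \<Rightarrow> bool" where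
  "minimal_dependency E v c \<longleftrightarrow>
     linear_dependency E v c \<and> support_in E c \<noteq> {} \<and>
     (\<forall>d. linear_dependency E v d \<and> support_in E d \<noteq> {} \<longrightarrow> \<not> support_in E d \<subset> support_in E c)"

definition signed_circuits :: "'i set \<Rightarrow> ('i \<Rightarrow> real ^ 'n) \<Rightarrow> ('i set \<times> 'i set) set" where
  "signed_circuits E v =
     {({i \<in> E. c i > 0}, {i \<in> E. c i < 0}) | c. minimal_dependency E v c}"

text \<open>
  The next two notions depend only on the oriented matroid, given by its ground set \<open>E\<close> and its set
  \<open>\<C>\<close> of signed circuits.
\<close>

definition acyclic_oriented_matroid :: "('i set \<times> 'i set) set \<Rightarrow> bool" where
  "acyclic_oriented_matroid \<C> \<longleftrightarrow> \<not> (\<exists>Xp Xn. (Xp, Xn) \<in> \<C> \<and> Xn = {})"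

text \<open>Colorings are extensional functions, so that each function on \<open>E\<close> is counted once.\<close>

definition transitive_colorings :: "'i set \<Rightarrow> ('i set \<times> 'i set) set \<Rightarrow> 'c set \<Rightarrow> ('i \<Rightarrow> 'c) set" where
  "transitive_colorings E \<C> K =
     {\<epsilon> \<in> E \<rightarrow>\<^sub>E K. \<forall>(Xp, Xn) \<in> \<C>. \<epsilon> ` Xp \<inter> \<epsilon> ` Xn \<noteq> {}}"

definition dual_hyperplane :: "real ^ 'n \<Rightarrow> (real ^ 'n) set" where
  "dual_hyperplane e = {x. x \<bullet> e = 0}"

definition chambers :: "'i set \<Rightarrow> ('i \<Rightarrow> real ^ 'n) \<Rightarrow> (real ^ 'n) set set" where
  "chambers E v = components (UNIV - (\<Union>i\<in>E. dual_hyperplane (v i)))"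

end

theory Submission
  imports Defs
begin

text \<open>
  Reading the two colors as signs, a coloring fails to be transitive exactly when the corresponding
  reorientation of the vectors has a positive circuit. By Gordan's alternative the reorientation has
  no such circuit iff all the reoriented vectors lie in a common open half space, i.e. iff the
  cell of the arrangement with that sign vector is nonempty; and the nonempty cells are the chambers.
\<close>

section \<open>Cells and Gordan's alternative\<close>

text \<open>Signs are real numbers, so that both vectors of 1 and -1 and the function
  \<open>sgn (x \<bullet> v i)\<close> fit. A zero sign at an index of \<open>E\<close> makes the
  cell empty.\<close>

definition cell :: "'i set \<Rightarrow> ('i \<Rightarrow> 'a::real_inner) \<Rightarrow> ('i \<Rightarrow> real) \<Rightarrow> 'a set" where
  "cell E v \<sigma> = {x. \<forall>i\<in>E. \<sigma> i * (x \<bullet> v i) > 0}"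

text \<open>If 0 lies in the convex hull of the vectors, its convex coefficients are the desired
  \<open>u\<close>; otherwise a hyperplane strictly separates 0 from the compact hull, and its
  normal is the desired \<open>x\<close>.\<close>

lemma gordan_alternative:
  fixes w :: "'i \<Rightarrow> 'a::euclidean_space"
  assumes "finite E"
  shows "(\<exists>x. \<forall>i\<in>E. x \<bullet> w i > 0) \<or>
    (\<exists>u. (\<forall>i\<in>E. u i \<ge> 0) \<and> (\<exists>i\<in>E. u i > 0) \<and> (\<Sum>i\<in>E. u i *\<^sub>R w i) = 0)"
proof (cases "0 \<in> convex hull (w ` E)")
  case True
  let ?C = "{\<Sum>i\<in>E. u i *\<^sub>R w i | u. (\<forall>i\<in>E. u i \<ge> 0) \<and> sum u E = 1}"
  have "convex ?C"
  proof (rule convexI)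
    fix x y :: 'a and s t :: real
    assume x: "x \<in> ?C" and y: "y \<in> ?C" and st: "0 \<le> s" "0 \<le> t" "s + t = 1"
    obtain f where f: "\<forall>i\<in>E. f i \<ge> 0" "sum f E = 1" "x = (\<Sum>i\<in>E. f i *\<^sub>R w i)"
      using x by auto
    obtain g where g: "\<forall>i\<in>E. g i \<ge> 0" "sum g E = 1" "y = (\<Sum>i\<in>E. g i *\<^sub>R w i)"
      using y by auto
    let ?h = "\<lambda>i. s * f i + t * g i"
    have "s *\<^sub>R x + t *\<^sub>R y = (\<Sum>i\<in>E. ?h i *\<^sub>R w i)"
      by (simp add: f g scaleR_sum_right sum.distrib algebra_simps)
    moreover have "sum ?h E = 1"
      using f g st by (simp add: sum.distrib flip: sum_distrib_left)
    ultimately show "s *\<^sub>R x + t *\<^sub>R y \<in> ?C"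
      using f g st by (intro CollectI exI[of _ ?h]) auto
  qed
  moreover have "w ` E \<subseteq> ?C"
  proof safe
    fix j assume "j \<in> E"
    then show "\<exists>u. w j = (\<Sum>i\<in>E. u i *\<^sub>R w i) \<and> (\<forall>i\<in>E. u i \<ge> 0) \<and> sum u E = 1"
      using assms
      by (intro exI[of _ "\<lambda>i. if i = j then 1 else 0"]) (simp add: if_distrib[of "\<lambda>r. r *\<^sub>R _"] cong: if_cong)
  qed
  ultimately have "convex hull (w ` E) \<subseteq> ?C"
    by (rule hull_minimal[rotated])
  then obtain u where u: "\<forall>i\<in>E. u i \<ge> 0" "sum u E = 1" "(\<Sum>i\<in>E. u i *\<^sub>R w i) = 0"
    using True by (auto dest!: subsetD)
  have "\<exists>i\<in>E. u i > 0"
    using u(2) sum_nonpos[of E u] by (fastforce simp: not_less)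
  with u show ?thesis by blast
next
  case False
  have "closed (convex hull (w ` E))"
    using assms by (simp add: compact_imp_closed finite_imp_compact_convex_hull)
  from separating_hyperplane_closed_0[OF convex_convex_hull this False]
  obtain a b where ab: "0 < b" "\<forall>x\<in>convex hull (w ` E). b < a \<bullet> x"
    by blast
  have "a \<bullet> w i > 0" if "i \<in> E" for i
    using ab hull_inc[of "w i" "w ` E" convex] that by fastforce
  then show ?thesis by blast
qed

section \<open>From nonnegative dependencies to circuits\<close>

lemma linear_dependency_diff:
  assumes "linear_dependency E v c" "linear_dependency E v d"
  shows "linear_dependency E v (\<lambda>i. c i - t * d i)"
proof -
  have "(\<Sum>i\<in>E. (c i - t * d i) *\<^sub>R v i) = (\<Sum>i\<in>E. c i *\<^sub>R v i) - t *\<^sub>R (\<Sum>i\<in>E. d i *\<^sub>R v i)"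
    by (simp add: scaleR_sum_right sum_subtractf algebra_simps)
  with assms show ?thesis by (simp add: linear_dependency_def)
qed

lemma linear_dependency_uminus:
  "linear_dependency E v (\<lambda>i. - c i) \<longleftrightarrow> linear_dependency E v c"
  by (simp add: linear_dependency_def sum_negf)

lemma support_in_uminus: "support_in E (\<lambda>i. - c i) = support_in E c"
  by (simp add: support_in_def)

lemma minimal_dependency_uminus:
  "minimal_dependency E v (\<lambda>i. - c i) \<longleftrightarrow> minimal_dependency E v c"
  by (simp add: minimal_dependency_def linear_dependency_uminus support_in_uminus)

text \<open>Subtract from \<open>c\<close> the largest multiple of \<open>d\<close> that keeps all
  coefficients nonnegative: some coefficient of \<open>c\<close> becomes 0 and no new index enters
  the support. The signs of \<open>d\<close> are arbitrary, as in the definition of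
  minimality.\<close>

lemma smaller_nonneg_dependency:
  assumes fin: "finite E"
    and c: "linear_dependency E v c" "\<forall>i\<in>E. c i \<ge> 0"
    and d: "linear_dependency E v d" "support_in E d \<noteq> {}" "support_in E d \<subset> support_in E c"
  shows "\<exists>e. linear_dependency E v e \<and> (\<forall>i\<in>E. e i \<ge> 0) \<and> support_in E e \<noteq> {} \<and>
    support_in E e \<subset> support_in E c"
proof -
  \<comment> \<open>Up to replacing \<open>d\<close> by its negative, some coefficient is positive,
    so the minimum below is over a nonempty set.\<close>
  obtain d where d: "linear_dependency E v d" "support_in E d \<subset> support_in E c" "\<exists>i\<in>E. d i > 0"
  proof (cases "\<exists>i\<in>E. d i > 0")
    case True
    then show ?thesis using that d by blast
  next
    case False
    then have "\<exists>i\<in>E. - d i > 0"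
      using d(2) by (force simp: support_in_def)
    then show ?thesis
      using that[of "\<lambda>i. - d i"] d by (simp add: linear_dependency_uminus support_in_uminus)
  qed
  let ?P = "{i \<in> E. d i > 0}"
  define t where "t = Min ((\<lambda>i. c i / d i) ` ?P)"
  have P: "finite ((\<lambda>i. c i / d i) ` ?P)" "(\<lambda>i. c i / d i) ` ?P \<noteq> {}"
    using fin d(3) by auto
  obtain k where k: "k \<in> E" "d k > 0" "t = c k / d k"
    using Min_in[OF P] unfolding t_def by auto
  have t0: "t \<ge> 0" using k c(2) by simp
  let ?e = "\<lambda>i. c i - t * d i"
  have "?e i \<ge> 0" if i: "i \<in> E" for i
  proof (cases "d i > 0")
    case True
    then have "t \<le> c i / d i"
      unfolding t_def using P(1) i by (intro Min_le) auto
    with True show ?thesis by (simp add: pos_le_divide_eq)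
  next
    case False
    then have "t * d i \<le> 0" using t0 by (simp add: mult_nonneg_nonpos)
    then show ?thesis using c(2) i by (meson diff_ge_0_iff_ge order_trans)
  qed
  moreover have "support_in E ?e \<subseteq> support_in E c"
    using d(2) by (auto simp: support_in_def)
  moreover have "k \<in> support_in E c" "k \<notin> support_in E ?e"
    using k d(2) by (auto simp: support_in_def)
  \<comment> \<open>Strictness of the inclusion keeps the new dependency nontrivial: at an index
    outside the support of \<open>d\<close>, the coefficient of \<open>c\<close> is
    unchanged.\<close>
  moreover obtain j where "j \<in> support_in E c" "j \<notin> support_in E d"
    using d(2) by blast
  then have "j \<in> support_in E ?e"
    by (simp add: support_in_def)
  ultimately show ?thesis
    using linear_dependency_diff[OF c(1) d(1)] by blast
qed

text \<open>Descent on the size of the support: as long as a nonnegative dependency is not minimal,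
  it can be replaced by a nonnegative one with strictly smaller support.\<close>

lemma nonneg_minimal_dependency_exists:
  assumes fin: "finite E"
    and "linear_dependency E v c" "\<forall>i\<in>E. c i \<ge> 0" "support_in E c \<noteq> {}"
  shows "\<exists>d. minimal_dependency E v d \<and> (\<forall>i\<in>E. d i \<ge> 0)"
  using assms(2-)
proof (induction "card (support_in E c)" arbitrary: c rule: less_induct)
  case less
  show ?case
  proof (cases "minimal_dependency E v c")
    case True
    with less.prems show ?thesis by blast
  next
    case False
    then obtain d where
      "linear_dependency E v d" "support_in E d \<noteq> {}" "support_in E d \<subset> support_in E c"
      using less.prems unfolding minimal_dependency_def by blast
    from smaller_nonneg_dependency[OF fin less.prems(1,2) this] obtain e where
      e: "linear_dependency E v e" "\<forall>i\<in>E. e i \<ge> 0" "support_in E e \<noteq> {}"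
        "support_in E e \<subset> support_in E c"
      by blast
    have "finite (support_in E c)" using fin by (simp add: support_in_def)
    with e show ?thesis using less.hyps psubset_card_mono by blast
  qed
qed

section \<open>Circuits as obstructions to nonempty cells\<close>

text \<open>Multiplying coefficients by the signs is an involution that exchanges dependencies of
  the two families and preserves supports, hence also minimality.\<close>

lemma minimal_dependency_reorient:
  assumes \<sigma>: "\<And>i. \<sigma> i \<in> {1, -1}"
    and "minimal_dependency E (\<lambda>i. \<sigma> i *\<^sub>R v i) c"
  shows "minimal_dependency E v (\<lambda>i. \<sigma> i * c i)"
proof -
  have \<sigma>0: "\<sigma> i \<noteq> 0" and \<sigma>2: "\<sigma> i * (\<sigma> i * r) = r" for i r
    using \<sigma>[of i] by auto
  have lin: "linear_dependency E (\<lambda>i. \<sigma> i *\<^sub>R v i) d = linear_dependency E v (\<lambda>i. \<sigma> i * d i)" for d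
    by (simp add: linear_dependency_def mult.commute)
  have supp: "support_in E (\<lambda>i. \<sigma> i * d i) = support_in E d" for d
    by (simp add: support_in_def \<sigma>0)
  have "\<not> support_in E d \<subset> support_in E c" if "linear_dependency E v d" "support_in E d \<noteq> {}" for d
  proof -
    have "linear_dependency E (\<lambda>i. \<sigma> i *\<^sub>R v i) (\<lambda>i. \<sigma> i * d i)"
      using that by (simp add: lin \<sigma>2)
    with assms(2) that show ?thesis
      unfolding minimal_dependency_def by (metis supp)
  qed
  with assms(2) show ?thesis
    by (simp add: minimal_dependency_def lin supp)
qed

lemma cell_empty_imp_circuit:
  assumes "finite E" and \<sigma>: "\<And>i. \<sigma> i \<in> {1, -1}" and "cell E v \<sigma> = {}"
  shows "\<exists>c. minimal_dependency E v c \<and> (\<forall>i\<in>E. \<sigma> i * c i \<ge> 0)"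
proof -
  let ?w = "\<lambda>i. \<sigma> i *\<^sub>R v i"
  have "\<not> (\<exists>x. \<forall>i\<in>E. x \<bullet> ?w i > 0)"
    using assms(3) by (auto simp: cell_def)
  then obtain u where "\<forall>i\<in>E. u i \<ge> 0" "\<exists>i\<in>E. u i > 0" "(\<Sum>i\<in>E. u i *\<^sub>R ?w i) = 0"
    using gordan_alternative[OF assms(1), of ?w] by blast
  then have "linear_dependency E ?w u" "\<forall>i\<in>E. u i \<ge> 0" "support_in E u \<noteq> {}"
    by (auto simp: linear_dependency_def support_in_def)
  from nonneg_minimal_dependency_exists[OF assms(1) this] obtain d where
    d: "minimal_dependency E ?w d" "\<forall>i\<in>E. d i \<ge> 0"
    by blast
  have "\<sigma> i * (\<sigma> i * d i) = d i" for i
    using \<sigma>[of i] by auto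
  with d minimal_dependency_reorient[OF \<sigma> d(1)] show ?thesis
    by (intro exI[of _ "\<lambda>i. \<sigma> i * d i"]) (simp only: simp_thms)
qed

text \<open>Pairing the dependency with \<open>x\<close> gives a vanishing sum whose terms are
  products of the nonnegative \<open>\<sigma> i * c i\<close> and the positive
  \<open>\<sigma> i * (x \<bullet> v i)\<close>. Every term is therefore 0.\<close>

lemma cell_dependency_zero:
  assumes "finite E" and \<sigma>: "\<And>i. \<sigma> i \<in> {1, -1}" and x: "x \<in> cell E v \<sigma>"
    and c: "linear_dependency E v c" "\<forall>i\<in>E. \<sigma> i * c i \<ge> 0" and "i \<in> E"
  shows "c i = 0"
proof -
  have eq: "c i * (x \<bullet> v i) = (\<sigma> i * c i) * (\<sigma> i * (x \<bullet> v i))" for i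
    using \<sigma>[of i] by auto
  have "(\<Sum>i\<in>E. c i * (x \<bullet> v i)) = x \<bullet> (\<Sum>i\<in>E. c i *\<^sub>R v i)"
    by (simp add: inner_sum_right)
  also have "\<dots> = 0"
    using c(1) by (simp add: linear_dependency_def)
  finally have "\<forall>i\<in>E. c i * (x \<bullet> v i) = 0"
    using assms(1) x c(2) unfolding eq
    by (subst (asm) sum_nonneg_eq_0_iff) (auto simp: cell_def intro: mult_nonneg_nonneg less_imp_le)
  moreover have "x \<bullet> v i \<noteq> 0"
    using x \<open>i \<in> E\<close> by (auto simp: cell_def)
  ultimately show ?thesis
    using \<open>i \<in> E\<close> by auto
qed

text \<open>Color \<open>a\<close> is read as +1 and \<open>b\<close> as -1. A circuit whose two
  parts share no color agrees with these signs, up to negation, and so excludes points of the cell.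
  Conversely, an empty cell yields a circuit agreeing with the signs, whose parts then have
  different colors.\<close>

lemma transitive_iff_cell_nonempty:
  fixes \<epsilon> :: "'i \<Rightarrow> 'c" and v :: "'i \<Rightarrow> real ^ 'n"
  defines "\<sigma> a i \<equiv> (if \<epsilon> i = a then 1 else - 1 :: real)"
  assumes fin: "finite E" and acyc: "acyclic_oriented_matroid (signed_circuits E v)"
    and ab: "a \<noteq> b" and \<epsilon>: "\<epsilon> \<in> E \<rightarrow>\<^sub>E {a, b}"
  shows "\<epsilon> \<in> transitive_colorings E (signed_circuits E v) {a, b} \<longleftrightarrow> cell E v (\<sigma> a) \<noteq> {}"
proof -
  have col: "\<epsilon> i = a \<or> \<epsilon> i = b" if "i \<in> E" for i
    using \<epsilon> that by auto
  have \<sigma>: "\<sigma> a i \<in> {1, -1}" for i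
    by (simp add: \<sigma>_def)
  have "\<epsilon> ` {i \<in> E. c i > 0} \<inter> \<epsilon> ` {i \<in> E. c i < 0} \<noteq> {}"
    if x: "x \<in> cell E v (\<sigma> a)" and c: "minimal_dependency E v c" for x c
  proof
    assume disj: "\<epsilon> ` {i \<in> E. c i > 0} \<inter> \<epsilon> ` {i \<in> E. c i < 0} = {}"
    \<comment> \<open>Acyclicity, applied to \<open>c\<close> and to its negative, makes both parts
      of the circuit nonempty. With only two colors and disjoint images, each part is then
      monochromatic.\<close>
    have neg: "{i \<in> E. d i < 0} \<noteq> {}" if "minimal_dependency E v d" for d
      using acyc that unfolding acyclic_oriented_matroid_def signed_circuits_def by blast
    obtain q where q: "q \<in> E" "c q < 0"
      using neg[OF c] by blast
    obtain p where p: "p \<in> E" "c p > 0"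
      using neg[of "\<lambda>i. - c i"] c by (auto simp: minimal_dependency_uminus)
    have pq: "\<epsilon> i \<noteq> \<epsilon> j" if "i \<in> E" "c i > 0" "j \<in> E" "c j < 0" for i j
      using disj that by blast
    have lin: "linear_dependency E v c"
      using c by (simp add: minimal_dependency_def)
    show False
    \<comment> \<open>The color of the positive part decides whether \<open>c\<close> or its
      negative agrees with the signs.\<close>
    proof (cases "\<epsilon> p = a")
      case True
      have "\<sigma> a i * c i \<ge> 0" if "i \<in> E" for i
        using pq[OF that _ q] pq[OF p that] pq[OF p q] col[OF that] col[OF q(1)] True
        by (cases "c i" "0::real" rule: linorder_cases) (auto simp: \<sigma>_def)
      with cell_dependency_zero[OF fin \<sigma> x lin _ p(1)] p show False by auto
    next
      case False
      have "\<sigma> a i * - c i \<ge> 0" if "i \<in> E" for i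
        using pq[OF that _ q] pq[OF p that] pq[OF p q] col[OF that] col[OF q(1)] col[OF p(1)] False
        by (cases "c i" "0::real" rule: linorder_cases) (auto simp: \<sigma>_def)
      with cell_dependency_zero[OF fin \<sigma> x, of "\<lambda>i. - c i" p] p lin show False
        by (auto simp: linear_dependency_uminus)
    qed
  qed
  moreover have "cell E v (\<sigma> a) \<noteq> {}"
    if "\<epsilon> \<in> transitive_colorings E (signed_circuits E v) {a, b}"
  proof
    assume "cell E v (\<sigma> a) = {}"
    from cell_empty_imp_circuit[OF fin \<sigma> this] obtain c where
      c: "minimal_dependency E v c" "\<forall>i\<in>E. \<sigma> a i * c i \<ge> 0"
      by blast
    have "({i \<in> E. c i > 0}, {i \<in> E. c i < 0}) \<in> signed_circuits E v"
      using c(1) by (auto simp: signed_circuits_def)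
    with that have "\<epsilon> ` {i \<in> E. c i > 0} \<inter> \<epsilon> ` {i \<in> E. c i < 0} \<noteq> {}"
      by (auto simp: transitive_colorings_def)
    \<comment> \<open>Equal colors give \<open>i\<close> and \<open>j\<close> the same sign, while
      their coefficients have opposite signs; one of the two products is thus negative.\<close>
    then obtain i j where "i \<in> E" "c i > 0" "j \<in> E" "c j < 0" "\<epsilon> i = \<epsilon> j"
      by auto
    then show False
      using c(2)[rule_format, of i] c(2)[rule_format, of j] by (auto simp: \<sigma>_def split: if_splits)
  qed
  ultimately show ?thesis
    using \<epsilon> unfolding transitive_colorings_def signed_circuits_def by blast
qed

section \<open>Chambers are the nonempty cells\<close>

lemma convex_cell: "convex (cell E v \<sigma>)"
proof -
  have "cell E v \<sigma> = (\<Inter>i\<in>E. {x. (\<sigma> i *\<^sub>R v i) \<bullet> x > 0})"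
    by (auto simp: cell_def inner_commute)
  then show ?thesis
    by (simp only: convex_INT convex_halfspace_gt)
qed

text \<open>A cell is convex, hence connected. It is maximal because a connected set leaving it
  would have to cross one of the hyperplanes.\<close>

lemma cell_in_chambers:
  assumes "cell E v \<sigma> \<noteq> {}"
  shows "cell E v \<sigma> \<in> chambers E v"
  unfolding chambers_def in_components_maximal
proof (intro conjI allI impI)
  show "cell E v \<sigma> \<subseteq> UNIV - (\<Union>i\<in>E. dual_hyperplane (v i))"
    by (auto simp: cell_def dual_hyperplane_def)
  show "connected (cell E v \<sigma>)"
    by (simp add: convex_cell convex_connected)
  fix D
  assume D: "D \<noteq> {} \<and> cell E v \<sigma> \<subseteq> D \<and> D \<subseteq> UNIV - (\<Union>i\<in>E. dual_hyperplane (v i)) \<and> connected D"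
  obtain x where x: "x \<in> cell E v \<sigma>"
    using assms by blast
  have "y \<in> cell E v \<sigma>" if y: "y \<in> D" for y
  proof (rule ccontr)
    assume "y \<notin> cell E v \<sigma>"
    then obtain i where i: "i \<in> E" "(\<sigma> i *\<^sub>R v i) \<bullet> y \<le> 0"
      by (auto simp: cell_def inner_commute not_less)
    moreover have "(\<sigma> i *\<^sub>R v i) \<bullet> x > 0"
      using x i by (auto simp: cell_def inner_commute)
    \<comment> \<open>The intermediate value theorem on \<open>D\<close> gives the zero;
      \<open>\<sigma> i\<close> is nonzero since the functional is positive at \<open>x\<close>, so
      \<open>z\<close> really lies on the hyperplane of \<open>v i\<close>.\<close>
    ultimately obtain z where z: "z \<in> D" "(\<sigma> i *\<^sub>R v i) \<bullet> z = 0" "\<sigma> i \<noteq> 0"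
      using connected_ivt_hyperplane[of D y x "\<sigma> i *\<^sub>R v i" 0] D x y by fastforce
    then have "z \<in> dual_hyperplane (v i)"
      by (simp add: dual_hyperplane_def inner_commute)
    with D z i show False by blast
  qed
  then show "D = cell E v \<sigma>"
    using D by blast
qed (use assms in simp)

text \<open>The cell given by the signs of \<open>x\<close> contains \<open>x\<close> and is itself
  a chamber, and two components with a common point coincide.\<close>

lemma cell_sgn_in_chambers:
  assumes "x \<in> C" "C \<in> chambers E v"
  shows "C = cell E v (\<lambda>i. sgn (x \<bullet> v i))"
proof -
  have "x \<bullet> v i \<noteq> 0" if "i \<in> E" for i
    using assms in_components_subset that unfolding chambers_def dual_hyperplane_def by blast
  then have x: "x \<in> cell E v (\<lambda>i. sgn (x \<bullet> v i))"
    by (force simp: cell_def sgn_if linorder_neq_iff)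
  then have "cell E v (\<lambda>i. sgn (x \<bullet> v i)) \<in> chambers E v"
    by (intro cell_in_chambers) blast
  with assms x show ?thesis
    unfolding chambers_def by (metis components_nonoverlap disjoint_iff)
qed

section \<open>The bijection and the count\<close>

lemma cell_cong:
  assumes "\<And>i. i \<in> E \<Longrightarrow> \<sigma> i = \<tau> i"
  shows "cell E v \<sigma> = cell E v \<tau>"
  using assms by (simp add: cell_def)

text \<open>Any point of the cell recovers the coloring, since the side of each hyperplane on which
  it lies determines the color. Coloring by the sides of a point of a given chamber gives
  surjectivity.\<close>

lemma bij_betw_colorings_chambers:
  fixes v :: "'i \<Rightarrow> real ^ 'n" and a b :: 'c
  assumes fin: "finite E" and acyc: "acyclic_oriented_matroid (signed_circuits E v)" and ab: "a \<noteq> b"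
  shows "bij_betw (\<lambda>\<epsilon>. cell E v (\<lambda>i. if \<epsilon> i = a then 1 else - 1))
    (transitive_colorings E (signed_circuits E v) {a, b}) (chambers E v)"
    (is "bij_betw ?f ?T _")
proof -
  have T: "\<epsilon> \<in> E \<rightarrow>\<^sub>E {a, b}" if "\<epsilon> \<in> ?T" for \<epsilon>
    using that by (simp add: transitive_colorings_def)
  note iff = transitive_iff_cell_nonempty[OF fin acyc ab]
  show ?thesis
    unfolding bij_betw_def
  proof (intro conjI subset_antisym subsetI)
    show "inj_on ?f ?T"
    proof (rule inj_onI)
      fix \<epsilon> \<delta> assume \<epsilon>: "\<epsilon> \<in> ?T" and \<delta>: "\<delta> \<in> ?T" and eq: "?f \<epsilon> = ?f \<delta>"
      obtain x where x: "x \<in> ?f \<epsilon>" "x \<in> ?f \<delta>"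
        using iff[OF T[OF \<epsilon>]] \<epsilon> eq by blast
      show "\<epsilon> = \<delta>"
      proof (rule PiE_ext[OF T[OF \<epsilon>] T[OF \<delta>]])
        fix i assume i: "i \<in> E"
        have "\<epsilon> i = a \<longleftrightarrow> \<delta> i = a"
          using x i by (force simp: cell_def split: if_splits)
        then show "\<epsilon> i = \<delta> i"
          using T[OF \<epsilon>] T[OF \<delta>] i by (auto dest!: PiE_mem)
      qed
    qed
  next
    fix C assume "C \<in> ?f ` ?T"
    then show "C \<in> chambers E v"
      using iff T cell_in_chambers by blast
  next
    fix C assume C: "C \<in> chambers E v"
    then obtain x where x: "x \<in> C"
      unfolding chambers_def using in_components_nonempty by blast
    note Ceq = cell_sgn_in_chambers[OF x C]
    \<comment> \<open>Positive side gets \<open>a\<close>, matching the sign +1 for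
      \<open>a\<close>; the restriction to \<open>E\<close> makes the coloring extensional.\<close>
    define \<epsilon> where "\<epsilon> = (\<lambda>i\<in>E. if x \<bullet> v i > 0 then a else b)"
    have \<epsilon>: "\<epsilon> \<in> E \<rightarrow>\<^sub>E {a, b}"
      by (auto simp: \<epsilon>_def)
    have "x \<bullet> v i \<noteq> 0" if "i \<in> E" for i
      using x Ceq that by (auto simp: cell_def)
    then have "C = ?f \<epsilon>"
      using ab by (subst Ceq, intro cell_cong) (auto simp: \<epsilon>_def sgn_if)
    moreover have "\<epsilon> \<in> ?T"
      using iff[OF \<epsilon>] x calculation by blast
    ultimately show "C \<in> ?f ` ?T" by blast
  qed
qed

theorem theorem1p17:
  fixes E :: "'i set" and v :: "'i \<Rightarrow> real ^ 'n" and K :: "'c set"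
  assumes "finite E"
    and "acyclic_oriented_matroid (signed_circuits E v)"
    and "card K = 2"
  shows "finite (chambers E v) \<and>
    card (transitive_colorings E (signed_circuits E v) K) = card (chambers E v)"
proof -
  obtain a b where K: "K = {a, b}" "a \<noteq> b"
    using assms(3) by (auto simp: card_2_iff)
  \<comment> \<open>Finiteness is proved for colorings and carried over to chambers by the
    bijection.\<close>
  have "transitive_colorings E (signed_circuits E v) K \<subseteq> E \<rightarrow>\<^sub>E K"
    by (auto simp: transitive_colorings_def)
  then have "finite (transitive_colorings E (signed_circuits E v) K)"
    by (rule finite_subset) (simp add: K assms(1) finite_PiE)
  with bij_betw_colorings_chambers[OF assms(1,2) K(2)] show ?thesis
    unfolding K(1) using bij_betw_finite bij_betw_same_card by blast
qed

end
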